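(* For any prime $p$ there exists a finite $p$-group $P$ with $\Phi(P) \leq \mathrm{Z}(P)$ such that $\mathcal{CD}(P)$ is a $2$-string of $2$-diamonds, meaning that there are subgroups $A_1, A_2, A, B_1, B_2$ of $P$ such that $AB_1$ and $AB_2$ are subgroups, $\mathcal{CD}(P) = \{ \mathrm{Z}(P), A_1, A_2, A, AB_1, AB_2, P \}$ (seven distinct subgroups), and $\mathrm{Z}(P) < A_i < A < AB_j < P$ for all $1 \leq i, j \leq 2$, where $\mathcal{CD}(P)$ is, as a lattice, a $2$-string of $2$-diamonds.
   Context: All groups are finite. For a finite group $G$ and $H \leq G$, the Chermak-Delgado measure of $H$ in $G$ is $m_G(H) = |H|\,|C_G(H)|$; $m^*(G)$ is the maximum of $m_G(H)$ over all $H \leq G$; and $\mathcal{CD}(G)$ (the Chermak-Delgado lattice) is the set of all $H \leq G$ with $m_G(H) = m^*(G)$, which is a sublattice of the subgroup lattice of $G$. $\Phi(P)$ is the Frattini subgroup and $\mathrm{Z}(P)$ the center. An $n$-diamond is a lattice isomorphic to the $n$-dimensional cube, i.e. the lattice of all subsets of an $n$-element set. An $n$-string of $m$-diamonds is a lattice obtained from $n$ $m$-diamonds by adjoining them end-to-end, the maximum of each component being identified with the minimum of the next one. $<$ denotes proper containment. *)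

theory Defs
  imports "HOL-Algebra.Coset" "HOL-Computational_Algebra.Primes"
begin

definition p_group :: "nat \<Rightarrow> ('a, 'b) monoid_scheme \<Rightarrow> bool" where
  "p_group p G \<longleftrightarrow> group G \<and> finite (carrier G) \<and> (\<exists>n. order G = p ^ n)"

definition centralizer :: "('a, 'b) monoid_scheme \<Rightarrow> 'a set \<Rightarrow> 'a set" where
  "centralizer G H = {g \<in> carrier G. \<forall>h\<in>H. g \<otimes>\<^bsub>G\<^esub> h = h \<otimes>\<^bsub>G\<^esub> g}"

definition center :: "('a, 'b) monoid_scheme \<Rightarrow> 'a set" where
  "center G = {z \<in> carrier G. \<forall>g\<in>carrier G. z \<otimes>\<^bsub>G\<^esub> g = g \<otimes>\<^bsub>G\<^esub> z}"

definition maximal_subgroup :: "'a set \<Rightarrow> ('a, 'b) monoid_scheme \<Rightarrow> bool" where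
  "maximal_subgroup M G \<longleftrightarrow> subgroup M G \<and> M \<noteq> carrier G \<and>
     (\<forall>H. subgroup H G \<and> M \<subseteq> H \<longrightarrow> H = M \<or> H = carrier G)"

text \<open>Intersecting with the carrier makes the Frattini subgroup of a group without maximal
  subgroups the whole group.\<close>

definition frattini :: "('a, 'b) monoid_scheme \<Rightarrow> 'a set" where
  "frattini G = carrier G \<inter> \<Inter> {M. maximal_subgroup M G}"

definition cd_measure :: "('a, 'b) monoid_scheme \<Rightarrow> 'a set \<Rightarrow> nat" where
  "cd_measure G H = card H * card (centralizer G H)"

definition max_cd_measure :: "('a, 'b) monoid_scheme \<Rightarrow> nat" where
  "max_cd_measure G = Max (cd_measure G ` {H. subgroup H G})"

definition CD :: "('a, 'b) monoid_scheme \<Rightarrow> 'a set set" where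
  "CD G = {H. subgroup H G \<and> cd_measure G H = max_cd_measure G}"

definition inclusion_order :: "'a set set \<Rightarrow> 'a set gorder" where
  "inclusion_order \<A> = \<lparr>carrier = \<A>, eq = (=), le = (\<subseteq>)\<rparr>"

text \<open>That both structures are lattices is part of \<^const>\<open>join_pres\<close> and \<^const>\<open>meet_pres\<close>.\<close>

definition lattice_iso ::
    "('a, 'c) gorder_scheme \<Rightarrow> ('b, 'd) gorder_scheme \<Rightarrow> ('a \<Rightarrow> 'b) \<Rightarrow> bool" where
  "lattice_iso L M f \<longleftrightarrow>
     bij_betw f (carrier L) (carrier M) \<and> join_pres L M f \<and> meet_pres L M f"

definition is_diamond :: "nat \<Rightarrow> ('a, 'c) gorder_scheme \<Rightarrow> bool" where
  "is_diamond n L \<longleftrightarrow> (\<exists>f. lattice_iso L (inclusion_order (Pow {..<n})) f)"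

text \<open>The components are the subsets \<open>D 0, \<dots>, D (n - 1)\<close> of the lattice, with the induced order.
  Since each element of \<open>D i\<close> lies below each element of \<open>D j\<close> for \<open>i < j\<close>, antisymmetry ensures
  that the components overlap only in the identified maxima and minima.\<close>

definition is_string_of_diamonds :: "nat \<Rightarrow> nat \<Rightarrow> ('a, 'c) gorder_scheme \<Rightarrow> bool" where
  "is_string_of_diamonds n m L \<longleftrightarrow> 0 < n \<and> lattice L \<and>
     (\<exists>D. carrier L = (\<Union>i<n. D i) \<and>
          (\<forall>i<n. is_diamond m (L\<lparr>carrier := D i\<rparr>)) \<and>
          (\<forall>i. Suc i < n \<longrightarrow> (\<exists>t. greatest L t (D i) \<and> least L t (D (Suc i)))) \<and>
          (\<forall>i j. i < j \<and> j < n \<longrightarrow> (\<forall>x \<in> D i. \<forall>y \<in> D j. x \<sqsubseteq>\<^bsub>L\<^esub> y)))"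

end

theory Submission
  imports Defs
begin

text \<open>Let \<open>V = V\<^sub>1 \<oplus> V\<^sub>2 \<oplus> W\<^sub>1 \<oplus> W\<^sub>2\<close> with all summands equal to \<open>F\<^sub>p\<^sup>2\<close>, and let
  \<open>P\<close> be the central extension of \<open>V\<close> whose commutator map consists of the tensor products
  \<open>W\<^sub>2 \<otimes> V\<^sub>1\<close> and \<open>W\<^sub>1 \<otimes> V\<^sub>2\<close> together with one alternating form \<open>\<omega>\<close> on
  \<open>W\<^sub>1 \<oplus> W\<^sub>2\<close>. Let \<open>A\<close> be the preimage of \<open>V\<^sub>1 \<oplus> V\<^sub>2\<close>. As \<open>s \<otimes> t = 0\<close> only if
  \<open>s = 0\<close> or \<open>t = 0\<close>, commuting subsets \<open>S\<close> of \<open>A\<close> and \<open>T\<close> of \<open>P\<close> are contained in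
  one of the pairs \<open>(Z(P), P)\<close>, \<open>(A\<^sub>1, AB\<^sub>1)\<close>, \<open>(A\<^sub>2, AB\<^sub>2)\<close>, \<open>(A, A)\<close>, and the
  orders in each pair multiply to \<open>|A|\<^sup>2\<close>. By the product formula, \<open>|A|\<^sup>2\<close> is the maximal
  measure, and a subgroup \<open>H\<close> attaining it, with centralizer \<open>K\<close>, has \<open>H \<inter> A\<close>,
  \<open>HA\<close>, \<open>K \<inter> A\<close>, \<open>KA\<close> among these seven subgroups. Since \<open>\<omega>\<close> does not vanish on
  any \<open>W\<^sub>i \<times> W\<^sub>j\<close>, one of \<open>H\<close> and \<open>K\<close> lies in \<open>A\<close>, so \<open>H = H \<inter> A\<close> or
  \<open>H = HA\<close>.\<close>

section \<open>Lattices of sets\<close>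

lemma least_inclusion_order:
  assumes "X \<in> F" "Y \<in> F"
  shows "least (inclusion_order F) s (Upper (inclusion_order F) {X, Y}) \<longleftrightarrow>
     s \<in> F \<and> X \<subseteq> s \<and> Y \<subseteq> s \<and> (\<forall>u\<in>F. X \<subseteq> u \<longrightarrow> Y \<subseteq> u \<longrightarrow> s \<subseteq> u)"
proof -
  have "Upper (inclusion_order F) {X, Y} = {u \<in> F. X \<subseteq> u \<and> Y \<subseteq> u}"
    using assms by (auto simp: Upper_def inclusion_order_def)
  then show ?thesis by (simp add: least_def inclusion_order_def) blast
qed

lemma greatest_inclusion_order:
  assumes "X \<in> F" "Y \<in> F"
  shows "greatest (inclusion_order F) s (Lower (inclusion_order F) {X, Y}) \<longleftrightarrow>
     s \<in> F \<and> s \<subseteq> X \<and> s \<subseteq> Y \<and> (\<forall>u\<in>F. u \<subseteq> X \<longrightarrow> u \<subseteq> Y \<longrightarrow> u \<subseteq> s)"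
proof -
  have "Lower (inclusion_order F) {X, Y} = {u \<in> F. u \<subseteq> X \<and> u \<subseteq> Y}"
    using assms by (auto simp: Lower_def inclusion_order_def)
  then show ?thesis by (simp add: greatest_def inclusion_order_def) blast
qed

lemma partial_order_inclusion: "partial_order (inclusion_order F)"
  by unfold_locales (auto simp: inclusion_order_def)

text \<open>\<open>join\<close> picks some least upper bound by choice, so its value can be computed
  only through uniqueness, which antisymmetry gives.\<close>

lemma join_inclusion_order_eq:
  assumes "X \<in> F" "Y \<in> F" "s \<in> F" "X \<subseteq> s" "Y \<subseteq> s" "\<And>u. u \<in> F \<Longrightarrow> X \<subseteq> u \<Longrightarrow> Y \<subseteq> u \<Longrightarrow> s \<subseteq> u"
  shows "X \<squnion>\<^bsub>inclusion_order F\<^esub> Y = s"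
  unfolding join_def sup_def
proof (rule some_equality)
  show "least (inclusion_order F) s (Upper (inclusion_order F) {X, Y})"
    using assms by (simp add: least_inclusion_order)
next
  fix t assume "least (inclusion_order F) t (Upper (inclusion_order F) {X, Y})"
  then show "t = s" unfolding least_inclusion_order[OF assms(1,2)]
    using assms(3-5) assms(6)[of t] by (meson subset_antisym)
qed

lemma meet_inclusion_order_eq:
  assumes "X \<in> F" "Y \<in> F" "s \<in> F" "s \<subseteq> X" "s \<subseteq> Y" "\<And>u. u \<in> F \<Longrightarrow> u \<subseteq> X \<Longrightarrow> u \<subseteq> Y \<Longrightarrow> u \<subseteq> s"
  shows "X \<sqinter>\<^bsub>inclusion_order F\<^esub> Y = s"
  unfolding meet_def inf_def
proof (rule some_equality)
  show "greatest (inclusion_order F) s (Lower (inclusion_order F) {X, Y})"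
    using assms by (simp add: greatest_inclusion_order)
next
  fix t assume "greatest (inclusion_order F) t (Lower (inclusion_order F) {X, Y})"
  then show "t = s" unfolding greatest_inclusion_order[OF assms(1,2)]
    using assms(3-5) assms(6)[of t] by (meson subset_antisym)
qed

lemma lattice_inclusion_order:
  assumes "\<And>X Y. X \<in> F \<Longrightarrow> Y \<in> F \<Longrightarrow>
      \<exists>s\<in>F. X \<subseteq> s \<and> Y \<subseteq> s \<and> (\<forall>u\<in>F. X \<subseteq> u \<longrightarrow> Y \<subseteq> u \<longrightarrow> s \<subseteq> u)"
    and "\<And>X Y. X \<in> F \<Longrightarrow> Y \<in> F \<Longrightarrow>
      \<exists>s\<in>F. s \<subseteq> X \<and> s \<subseteq> Y \<and> (\<forall>u\<in>F. u \<subseteq> X \<longrightarrow> u \<subseteq> Y \<longrightarrow> u \<subseteq> s)"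
  shows "lattice (inclusion_order F)"
proof -
  interpret partial_order "inclusion_order F" by (rule partial_order_inclusion)
  have c: "carrier (inclusion_order F) = F" by (simp add: inclusion_order_def)
  show ?thesis
  proof
    fix X Y assume "X \<in> carrier (inclusion_order F)" "Y \<in> carrier (inclusion_order F)"
    then have XY: "X \<in> F" "Y \<in> F" by (simp_all add: c)
    show "\<exists>s. least (inclusion_order F) s (Upper (inclusion_order F) {X, Y})"
      using assms(1)[OF XY] XY by (simp add: least_inclusion_order Bex_def)
    show "\<exists>s. greatest (inclusion_order F) s (Lower (inclusion_order F) {X, Y})"
      using assms(2)[OF XY] XY by (simp add: greatest_inclusion_order Bex_def)
  qed
qed

text \<open>The order embedding pulls joins and meets back: the preimage of
  \<open>f X \<union> f Y\<close> is the join of \<open>X\<close> and \<open>Y\<close>, and dually.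
  Thus \<open>F\<close> is found to be a lattice along the way.\<close>

lemma lattice_iso_inclusion_order:
  assumes img: "f ` F = F'"
    and emb: "\<And>X Y. X \<in> F \<Longrightarrow> Y \<in> F \<Longrightarrow> f X \<subseteq> f Y \<longleftrightarrow> X \<subseteq> Y"
    and Un: "\<And>U V. U \<in> F' \<Longrightarrow> V \<in> F' \<Longrightarrow> U \<union> V \<in> F'"
    and Int: "\<And>U V. U \<in> F' \<Longrightarrow> V \<in> F' \<Longrightarrow> U \<inter> V \<in> F'"
  shows "lattice_iso (inclusion_order F) (inclusion_order F') f"
proof -
  have sup: "\<exists>s\<in>F. f s = f X \<union> f Y \<and> X \<subseteq> s \<and> Y \<subseteq> s \<and> (\<forall>u\<in>F. X \<subseteq> u \<longrightarrow> Y \<subseteq> u \<longrightarrow> s \<subseteq> u)"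
    if XY: "X \<in> F" "Y \<in> F" for X Y
  proof -
    obtain s where s: "s \<in> F" "f s = f X \<union> f Y" using Un XY img by (metis (no_types) imageE imageI)
    have "X \<subseteq> s" "Y \<subseteq> s" using emb XY s by (metis Un_upper1, metis Un_upper2)
    moreover have "s \<subseteq> u" if "u \<in> F" "X \<subseteq> u" "Y \<subseteq> u" for u
      using emb XY s that by (metis Un_least)
    ultimately show ?thesis using s by blast
  qed
  have inf: "\<exists>s\<in>F. f s = f X \<inter> f Y \<and> s \<subseteq> X \<and> s \<subseteq> Y \<and> (\<forall>u\<in>F. u \<subseteq> X \<longrightarrow> u \<subseteq> Y \<longrightarrow> u \<subseteq> s)"
    if XY: "X \<in> F" "Y \<in> F" for X Y
  proof -
    obtain s where s: "s \<in> F" "f s = f X \<inter> f Y" using Int XY img by (metis (no_types) imageE imageI)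
    have "s \<subseteq> X" "s \<subseteq> Y" using emb XY s by (metis Int_lower1, metis Int_lower2)
    moreover have "u \<subseteq> s" if "u \<in> F" "u \<subseteq> X" "u \<subseteq> Y" for u
      using emb XY s that by (metis Int_greatest)
    ultimately show ?thesis using s by blast
  qed
  have inj: "inj_on f F" using emb by (intro inj_onI) (metis order_refl subset_antisym)
  have lat: "lattice (inclusion_order F)"
  proof (rule lattice_inclusion_order)
    fix X Y assume XY: "X \<in> F" "Y \<in> F"
    show "\<exists>s\<in>F. X \<subseteq> s \<and> Y \<subseteq> s \<and> (\<forall>u\<in>F. X \<subseteq> u \<longrightarrow> Y \<subseteq> u \<longrightarrow> s \<subseteq> u)"
      using sup[OF XY] by blast
    show "\<exists>s\<in>F. s \<subseteq> X \<and> s \<subseteq> Y \<and> (\<forall>u\<in>F. u \<subseteq> X \<longrightarrow> u \<subseteq> Y \<longrightarrow> u \<subseteq> s)"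
      using inf[OF XY] by blast
  qed
  have lat': "lattice (inclusion_order F')"
  proof (rule lattice_inclusion_order)
    fix X Y assume XY: "X \<in> F'" "Y \<in> F'"
    show "\<exists>s\<in>F'. X \<subseteq> s \<and> Y \<subseteq> s \<and> (\<forall>u\<in>F'. X \<subseteq> u \<longrightarrow> Y \<subseteq> u \<longrightarrow> s \<subseteq> u)"
      by (rule bexI[OF _ Un[OF XY]]) simp
    show "\<exists>s\<in>F'. s \<subseteq> X \<and> s \<subseteq> Y \<and> (\<forall>u\<in>F'. u \<subseteq> X \<longrightarrow> u \<subseteq> Y \<longrightarrow> u \<subseteq> s)"
      by (rule bexI[OF _ Int[OF XY]]) simp
  qed
  have join: "f (X \<squnion>\<^bsub>inclusion_order F\<^esub> Y) = f X \<squnion>\<^bsub>inclusion_order F'\<^esub> f Y"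
    if XY: "X \<in> F" "Y \<in> F" for X Y
  proof -
    obtain s where s: "s \<in> F" "f s = f X \<union> f Y" "X \<subseteq> s" "Y \<subseteq> s"
        "\<forall>u\<in>F. X \<subseteq> u \<longrightarrow> Y \<subseteq> u \<longrightarrow> s \<subseteq> u"
      using sup[OF XY] by (elim bexE conjE)
    have "X \<squnion>\<^bsub>inclusion_order F\<^esub> Y = s" by (rule join_inclusion_order_eq[OF XY s(1,3,4)]) (simp add: s(5))
    moreover have "f X \<squnion>\<^bsub>inclusion_order F'\<^esub> f Y = f X \<union> f Y"
      using XY img by (intro join_inclusion_order_eq Un) auto
    ultimately show ?thesis by (simp add: s)
  qed
  have meet: "f (X \<sqinter>\<^bsub>inclusion_order F\<^esub> Y) = f X \<sqinter>\<^bsub>inclusion_order F'\<^esub> f Y"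
    if XY: "X \<in> F" "Y \<in> F" for X Y
  proof -
    obtain s where s: "s \<in> F" "f s = f X \<inter> f Y" "s \<subseteq> X" "s \<subseteq> Y"
        "\<forall>u\<in>F. u \<subseteq> X \<longrightarrow> u \<subseteq> Y \<longrightarrow> u \<subseteq> s"
      using inf[OF XY] by (elim bexE conjE)
    have "X \<sqinter>\<^bsub>inclusion_order F\<^esub> Y = s" by (rule meet_inclusion_order_eq[OF XY s(1,3,4)]) (simp add: s(5))
    moreover have "f X \<sqinter>\<^bsub>inclusion_order F'\<^esub> f Y = f X \<inter> f Y"
      using XY img by (intro meet_inclusion_order_eq Int) auto
    ultimately show ?thesis by (simp add: s)
  qed
  have "carrier (inclusion_order F) = F" "carrier (inclusion_order F') = F'"
    by (simp_all add: inclusion_order_def)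
  then show ?thesis
    using lat lat' join meet inj img by (simp add: lattice_iso_def join_pres_def meet_pres_def bij_betw_def)
qed

lemma is_diamond_2_inclusion_order:
  assumes "Z \<subset> X" "Z \<subset> Y" "X \<subset> T" "Y \<subset> T" "\<not> X \<subseteq> Y" "\<not> Y \<subseteq> X"
  shows "is_diamond 2 (inclusion_order {Z, X, Y, T})"
proof -
  \<comment> \<open>Each set goes to the indices of the two middle elements \<open>X\<close> and
    \<open>Y\<close> that lie below it.\<close>
  define f where "f = (\<lambda>S. (if X \<subseteq> S then {0::nat} else {}) \<union> (if Y \<subseteq> S then {1} else {}))"
  have f: "f Z = {}" "f X = {0}" "f Y = {1}" "f T = {0, 1}"
    using assms by (auto simp: f_def)
  have "Pow {..<2::nat} = {{}, {0}, {1}, {0, 1}}"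
    by (auto simp: numeral_2_eq_2 lessThan_Suc Pow_insert)
  then have "f ` {Z, X, Y, T} = Pow {..<2}" by (simp add: f)
  moreover have "f U \<subseteq> f V \<longleftrightarrow> U \<subseteq> V" if "U \<in> {Z, X, Y, T}" "V \<in> {Z, X, Y, T}" for U V
    using that assms by (auto simp: f)
  ultimately show ?thesis
    unfolding is_diamond_def by (intro exI lattice_iso_inclusion_order) auto
qed

lemma is_string_of_diamonds_2_2_inclusion_order:
  assumes sub: "Z \<subset> A1" "Z \<subset> A2" "A1 \<subset> A" "A2 \<subset> A" "A \<subset> X1" "A \<subset> X2" "X1 \<subset> T" "X2 \<subset> T"
    and inc: "\<not> A1 \<subseteq> A2" "\<not> A2 \<subseteq> A1" "\<not> X1 \<subseteq> X2" "\<not> X2 \<subseteq> X1"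
  shows "is_string_of_diamonds 2 2 (inclusion_order {Z, A1, A2, A, X1, X2, T})"
proof -
  let ?F = "{Z, A1, A2, A, X1, X2, T}"
  have rel: "\<not> A1 \<subseteq> Z" "\<not> A2 \<subseteq> Z" "\<not> A \<subseteq> Z" "\<not> X1 \<subseteq> Z" "\<not> X2 \<subseteq> Z" "\<not> T \<subseteq> Z"
    "\<not> A \<subseteq> A1" "\<not> X1 \<subseteq> A1" "\<not> X2 \<subseteq> A1" "\<not> T \<subseteq> A1" "\<not> A \<subseteq> A2" "\<not> X1 \<subseteq> A2" "\<not> X2 \<subseteq> A2" "\<not> T \<subseteq> A2"
    "\<not> X1 \<subseteq> A" "\<not> X2 \<subseteq> A" "\<not> T \<subseteq> A" "\<not> T \<subseteq> X1" "\<not> T \<subseteq> X2"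
    "Z \<subseteq> A1" "Z \<subseteq> A2" "Z \<subseteq> A" "Z \<subseteq> X1" "Z \<subseteq> X2" "Z \<subseteq> T"
    "A1 \<subseteq> A" "A1 \<subseteq> X1" "A1 \<subseteq> X2" "A1 \<subseteq> T" "A2 \<subseteq> A" "A2 \<subseteq> X1" "A2 \<subseteq> X2" "A2 \<subseteq> T"
    "A \<subseteq> X1" "A \<subseteq> X2" "A \<subseteq> T" "X1 \<subseteq> T" "X2 \<subseteq> T"
    using sub by order+
  \<comment> \<open>Birkhoff representation: \<open>A1\<close>, \<open>A2\<close>,
    \<open>X1\<close>, \<open>X2\<close> are the join-irreducible elements, and each member goes to
    the set of those below it.\<close>
  define f where "f = (\<lambda>S. (if A1 \<subseteq> S then {0::nat} else {}) \<union> (if A2 \<subseteq> S then {1} else {}) \<union>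
    (if X1 \<subseteq> S then {2} else {}) \<union> (if X2 \<subseteq> S then {3} else {}))"
  define F' where "F' = {{}, {0}, {1}, {0,1}, {0,1,2}, {0,1,3}, {0,1,2,3::nat}}"
  have f: "f Z = {}" "f A1 = {0}" "f A2 = {1}" "f A = {0, 1}" "f X1 = {0,1,2}" "f X2 = {0,1,3}"
    "f T = {0,1,2,3}"
    by (simp_all add: f_def rel inc insert_commute)
  have emb: "f U \<subseteq> f V \<longleftrightarrow> U \<subseteq> V" if "U \<in> ?F" "V \<in> ?F" for U V
  proof -
    show ?thesis using that by (elim insertE emptyE) (simp_all only: f rel inc order_refl, simp_all)
  qed
  have "lattice_iso (inclusion_order ?F) (inclusion_order F') f"
  proof (rule lattice_iso_inclusion_order)
    show "f ` ?F = F'" by (simp add: f F'_def insert_commute)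
    fix U V assume "U \<in> F'" "V \<in> F'"
    then show "U \<union> V \<in> F'" "U \<inter> V \<in> F'"
      unfolding F'_def by (elim insertE emptyE; auto)+
  qed (rule emb)
  then have lat: "lattice (inclusion_order ?F)" by (simp add: lattice_iso_def join_pres_def)
  \<comment> \<open>The two diamonds share \<open>A\<close>, the maximum of the first and the
    minimum of the second.\<close>
  define D where "D = (\<lambda>i::nat. if i = 0 then {Z, A1, A2, A} else {A, X1, X2, T})"
  have car: "carrier (inclusion_order F) = F" "le (inclusion_order F) = (\<subseteq>)"
    "(inclusion_order F)\<lparr>carrier := S\<rparr> = inclusion_order S" for F S :: "'a set set"
    by (simp_all add: inclusion_order_def)
  have "{..<2::nat} = {0, 1}" by auto
  then have "?F = (\<Union>i<2. D i)" by (simp add: D_def insert_commute)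
  moreover have "is_diamond 2 ((inclusion_order ?F)\<lparr>carrier := D i\<rparr>)" for i
    unfolding car D_def using is_diamond_2_inclusion_order[OF sub(1-4) inc(1,2)]
      is_diamond_2_inclusion_order[OF sub(5-8) inc(3,4)] by simp
  moreover have "\<exists>t. greatest (inclusion_order ?F) t (D i) \<and> least (inclusion_order ?F) t (D (Suc i))"
    if "Suc i < 2" for i
    using that by (intro exI[of _ A]) (simp add: greatest_def least_def car D_def rel)
  moreover have "x \<subseteq> y" if "x \<in> D i" "y \<in> D j" "i < j" "j < 2" for i j x y
  proof -
    have "i = 0" "j = 1" using that by simp_all
    then have "x \<in> {Z, A1, A2, A}" "y \<in> {A, X1, X2, T}" using that by (simp_all add: D_def)
    then have "x = Z \<or> x = A1 \<or> x = A2 \<or> x = A" "y = A \<or> y = X1 \<or> y = X2 \<or> y = T" by simp_all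
    then have "x \<subseteq> A" "A \<subseteq> y" by (metis rel order_refl)+
    then show ?thesis by (rule subset_trans)
  qed
  ultimately show ?thesis
    unfolding is_string_of_diamonds_def car using lat
    by (intro conjI exI[of _ D]) auto
qed

section \<open>Subgroups of maximal measure\<close>

text \<open>Counts \<open>H \<times> N\<close> by the fibres of multiplication: the pairs with
  product \<open>h \<otimes> n\<close> are exactly \<open>(h \<otimes> d, inv d \<otimes> n)\<close>
  for \<open>d\<close> in \<open>H \<inter> N\<close>.\<close>

lemma (in group) card_set_mult_subgroups:
  assumes fin: "finite (carrier G)" and H: "subgroup H G" and N: "subgroup N G"
  shows "card (H <#> N) * card (H \<inter> N) = card H * card N"
proof -
  interpret H: subgroup H G by fact
  interpret N: subgroup N G by fact
  have finHN: "finite H" "finite N" using fin H.subset N.subset finite_subset by blast+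
  define f where "f = (\<lambda>(h, n). h \<otimes> n)"
  have fiber: "card {z \<in> H \<times> N. f z = y} = card (H \<inter> N)" if y: "y \<in> f ` (H \<times> N)" for y
  proof -
    obtain h n where hn: "h \<in> H" "n \<in> N" "y = h \<otimes> n" using y by (auto simp: f_def)
    then have c: "h \<in> carrier G" "n \<in> carrier G" by auto
    have "bij_betw (\<lambda>d. (h \<otimes> d, inv d \<otimes> n)) (H \<inter> N) {z \<in> H \<times> N. f z = y}"
    proof (rule bij_betwI[where g = "\<lambda>(a, b). inv h \<otimes> a"])
      show "(\<lambda>d. (h \<otimes> d, inv d \<otimes> n)) \<in> H \<inter> N \<rightarrow> {z \<in> H \<times> N. f z = y}"
      proof
        fix d assume d: "d \<in> H \<inter> N"
        then have "h \<otimes> d \<otimes> (inv d \<otimes> n) = y" using c hn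
          by (simp add: m_assoc inv_solve_left' flip: m_assoc[of d])
        then show "(h \<otimes> d, inv d \<otimes> n) \<in> {z \<in> H \<times> N. f z = y}" using d hn by (auto simp: f_def)
      qed
      show "(\<lambda>(a, b). inv h \<otimes> a) \<in> {z \<in> H \<times> N. f z = y} \<rightarrow> H \<inter> N"
      proof
        fix z assume "z \<in> {z \<in> H \<times> N. f z = y}"
        then obtain a b where ab: "z = (a, b)" "a \<in> H" "b \<in> N" "a \<otimes> b = h \<otimes> n"
          by (auto simp: f_def hn)
        then have "inv h \<otimes> a = n \<otimes> inv b"
          using c by (metis H.mem_carrier N.mem_carrier inv_closed inv_solve_left inv_solve_right m_assoc m_closed)
        then have "inv h \<otimes> a \<in> N" using ab hn by simp
        then show "(\<lambda>(a, b). inv h \<otimes> a) z \<in> H \<inter> N" using ab hn by simp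
      qed
    next
      fix d assume "d \<in> H \<inter> N"
      then show "(\<lambda>(a, b). inv h \<otimes> a) (h \<otimes> d, inv d \<otimes> n) = d" using c
        by (simp flip: m_assoc)
    next
      fix z assume "z \<in> {z \<in> H \<times> N. f z = y}"
      then obtain a b where ab: "z = (a, b)" "a \<in> H" "b \<in> N" "a \<otimes> b = h \<otimes> n"
        by (auto simp: f_def hn)
      then have cab: "a \<in> carrier G" "b \<in> carrier G" by auto
      have "h \<otimes> (inv h \<otimes> a) = a" using c cab by (simp flip: m_assoc)
      moreover have "inv (inv h \<otimes> a) \<otimes> n = b"
        using c cab ab(4) by (metis inv_closed inv_inv inv_mult_group inv_solve_left m_assoc m_closed)
      ultimately show "(h \<otimes> ((\<lambda>(a, b). inv h \<otimes> a) z), inv ((\<lambda>(a, b). inv h \<otimes> a) z) \<otimes> n) = z"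
        by (simp add: ab)
    qed
    then show ?thesis by (simp add: bij_betw_same_card)
  qed
  have img: "f ` (H \<times> N) = H <#> N" by (auto simp: f_def set_mult_def)
  have "card H * card N = (\<Sum>z\<in>H \<times> N. 1)" by (simp add: card_cartesian_product)
  also have "\<dots> = (\<Sum>y\<in>f ` (H \<times> N). card {z \<in> H \<times> N. f z = y})"
    using sum.image_gen[of "H \<times> N" "\<lambda>_. 1::nat" f] finHN by simp
  also have "\<dots> = (\<Sum>y\<in>f ` (H \<times> N). card (H \<inter> N))" by (rule sum.cong) (use fiber in auto)
  finally show ?thesis by (simp add: img)
qed

lemma (in group) subgroup_centralizer:
  assumes "H \<subseteq> carrier G"
  shows "subgroup (centralizer G H) G"
proof (rule subgroupI)
  show "centralizer G H \<noteq> {}" using assms by (force simp: centralizer_def)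
next
  fix a assume a: "a \<in> centralizer G H"
  have ac: "a \<in> carrier G" using a by (simp add: centralizer_def)
  have "inv a \<otimes> h = h \<otimes> inv a" if "h \<in> H" for h
  proof -
    have h: "h \<in> carrier G" "a \<otimes> h = h \<otimes> a" using a that assms by (auto simp: centralizer_def)
    have "inv a \<otimes> (a \<otimes> h) \<otimes> inv a = h \<otimes> inv a" using h(1) ac by (simp flip: m_assoc)
    moreover have "inv a \<otimes> (h \<otimes> a) \<otimes> inv a = inv a \<otimes> h" using h(1) ac by (simp add: m_assoc)
    ultimately show ?thesis using h(2) by simp
  qed
  then show "inv a \<in> centralizer G H" using a by (simp add: centralizer_def)
next
  fix a b assume "a \<in> centralizer G H" "b \<in> centralizer G H"
  then have ab: "a \<in> carrier G" "b \<in> carrier G"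
    "\<And>h. h \<in> H \<Longrightarrow> a \<otimes> h = h \<otimes> a \<and> b \<otimes> h = h \<otimes> b" by (auto simp: centralizer_def)
  have "a \<otimes> b \<otimes> h = h \<otimes> (a \<otimes> b)" if "h \<in> H" for h
  proof -
    have h: "h \<in> carrier G" using that assms by blast
    have "a \<otimes> b \<otimes> h = a \<otimes> (h \<otimes> b)" using ab(1,2) ab(3)[OF that] h by (simp add: m_assoc)
    also have "\<dots> = h \<otimes> a \<otimes> b" using ab(1,2) ab(3)[OF that] h by (simp flip: m_assoc)
    also have "\<dots> = h \<otimes> (a \<otimes> b)" using ab h by (simp add: m_assoc)
    finally show ?thesis .
  qed
  then show "a \<otimes> b \<in> centralizer G H" using ab by (simp add: centralizer_def)
qed (auto simp: centralizer_def)

lemma mult_le_eqD: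
  fixes a b c d :: nat
  assumes "a \<le> c" "b \<le> d" "a * b = c * d" "0 < c" "0 < d"
  shows "a = c" "b = d"
proof -
  have "0 < a" "0 < b" using assms by (metis mult_is_0 neq0_conv)+
  then show "a = c" "b = d" using assms
    by (metis mult_less_le_imp_less le_neq_implies_less less_irrefl order_refl zero_le,
        metis mult_le_less_imp_less le_neq_implies_less less_irrefl order_refl zero_le)
qed

text \<open>For \<open>K = C(H)\<close> the product formula gives
  \<open>|H| |K| |A|\<^sup>2 = |H \<inter> A| |HA| |K \<inter> A| |KA|\<close>, and the pairs
  covering \<open>(H \<inter> A, K)\<close> and \<open>(K \<inter> A, H)\<close> bound the right-hand side.\<close>

lemma (in group) CD_eq_dual_pairs:
  assumes fin: "finite (carrier G)" and A: "subgroup A G"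
    and pairs: "\<And>L X. (L, X) \<in> \<P> \<Longrightarrow> subgroup L G \<and> subgroup X G \<and> L \<subseteq> A \<and> A \<subseteq> X \<and>
      X \<subseteq> centralizer G L \<and> card L * card X = card A * card A"
    and cover: "\<And>S T. S \<subseteq> A \<Longrightarrow> T \<subseteq> centralizer G S \<Longrightarrow> \<exists>L X. (L, X) \<in> \<P> \<and> S \<subseteq> L \<and> T \<subseteq> X"
    and nondeg: "\<And>L X L' X'. (L, X) \<in> \<P> \<Longrightarrow> (L', X') \<in> \<P> \<Longrightarrow> X \<noteq> A \<Longrightarrow> X' \<noteq> A \<Longrightarrow>
      \<exists>x\<in>X. \<exists>y\<in>X'. \<forall>a\<in>A. \<forall>b\<in>A. (x \<otimes> a) \<otimes> (y \<otimes> b) \<noteq> (y \<otimes> b) \<otimes> (x \<otimes> a)"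
  shows "CD G = fst ` \<P> \<union> snd ` \<P>"
proof -
  interpret A: subgroup A G by fact
  have finS: "finite S" if "S \<subseteq> carrier G" for S using fin that finite_subset by blast
  have pos: "0 < card S" if "subgroup S G" for S
    using that finS subgroup.subset subgroup.one_closed by (metis card_gt_0_iff empty_iff)
  have upper: "cd_measure G H \<le> card A * card A \<and>
      (cd_measure G H = card A * card A \<longrightarrow> H \<in> fst ` \<P> \<union> snd ` \<P>)" if H: "subgroup H G" for H
  proof -
    interpret H: subgroup H G by fact
    define K where "K = centralizer G H"
    have K: "subgroup K G" unfolding K_def by (rule subgroup_centralizer) (rule H.subset)
    interpret K: subgroup K G by fact
    have comm: "h \<otimes> k = k \<otimes> h" if "h \<in> H" "k \<in> K" for h k
    proof -
      have "\<forall>h\<in>H. k \<otimes> h = h \<otimes> k" using that(2) unfolding K_def centralizer_def by blast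
      then show ?thesis using that(1) by metis
    qed
    have "K \<subseteq> centralizer G (H \<inter> A)"
    proof
      fix k assume k: "k \<in> K"
      then have "k \<otimes> h = h \<otimes> k" if "h \<in> H \<inter> A" for h using that comm[of h k] by simp
      then show "k \<in> centralizer G (H \<inter> A)" using K.mem_carrier[OF k] unfolding centralizer_def by blast
    qed
    then obtain L X where LX: "(L, X) \<in> \<P>" "H \<inter> A \<subseteq> L" "K \<subseteq> X"
      using cover[OF Int_lower2, of K H] by metis
    have "H \<subseteq> centralizer G (K \<inter> A)"
    proof
      fix h assume h: "h \<in> H"
      then have "h \<otimes> k = k \<otimes> h" if "k \<in> K \<inter> A" for k using that comm[of h k] by simp
      then show "h \<in> centralizer G (K \<inter> A)" using H.mem_carrier[OF h] unfolding centralizer_def by blast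
    qed
    then obtain L' X' where LX': "(L', X') \<in> \<P>" "K \<inter> A \<subseteq> L'" "H \<subseteq> X'"
      using cover[OF Int_lower2, of H K] by metis
    note p = pairs[OF LX(1)] and p' = pairs[OF LX'(1)]
    have cards: "card L * card X = card A * card A" "card L' * card X' = card A * card A"
      using p p' by blast+
    have mult: "S <#> A \<subseteq> Y" if "subgroup Y G" "A \<subseteq> Y" "S \<subseteq> Y" for S Y
      using that subgroup.m_closed[OF that(1)] by (auto simp: set_mult_def)
    have HA: "H <#> A \<subseteq> X'" by (rule mult) (use p' LX'(3) in simp_all)
    have KA: "K <#> A \<subseteq> X" by (rule mult) (use p LX(3) in simp_all)
    have sub: "subgroup L G" "subgroup X G" "subgroup L' G" "subgroup X' G" using p p' by simp_all
    note finX = sub[THEN subgroup.subset, THEN finS]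
    note posX = sub[THEN pos] pos[OF A]
    have le: "card (H \<inter> A) \<le> card L" "card (K <#> A) \<le> card X"
      "card (K \<inter> A) \<le> card L'" "card (H <#> A) \<le> card X'"
      by (rule card_mono[OF finX(1) LX(2)] card_mono[OF finX(2) KA] card_mono[OF finX(3) LX'(2)]
        card_mono[OF finX(4) HA])+
    have prod: "cd_measure G H * (card A * card A) =
        (card (H \<inter> A) * card (K <#> A)) * (card (K \<inter> A) * card (H <#> A))"
    proof -
      have "cd_measure G H * (card A * card A) = (card H * card A) * (card K * card A)"
        by (simp add: cd_measure_def K_def)
      then show ?thesis
        unfolding card_set_mult_subgroups[OF fin H A, symmetric] card_set_mult_subgroups[OF fin K A, symmetric]
        by simp
    qed
    have le2: "card (H \<inter> A) * card (K <#> A) \<le> card A * card A"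
       "card (K \<inter> A) * card (H <#> A) \<le> card A * card A"
      using mult_le_mono[OF le(1,2)] mult_le_mono[OF le(3,4)] cards by simp_all
    have "cd_measure G H * (card A * card A) \<le> (card A * card A) * (card A * card A)"
      unfolding prod by (intro mult_le_mono le2)
    then have "cd_measure G H \<le> card A * card A" using posX by simp
    moreover have "H \<in> fst ` \<P> \<union> snd ` \<P>" if eq: "cd_measure G H = card A * card A"
    proof -
      \<comment> \<open>Equality in the product of the four bounds forces equality in each of them,
        so \<open>H \<inter> A\<close>, \<open>H <#> A\<close> and \<open>K <#> A\<close> are
        members of pairs.\<close>
      have "0 < card A * card A" using posX by simp
      then have e: "card (H \<inter> A) * card (K <#> A) = card L * card X"
        "card (K \<inter> A) * card (H <#> A) = card L' * card X'"
        using mult_le_eqD[OF le2] prod[unfolded eq] cards by simp_all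
      note e1 = mult_le_eqD[OF le(1,2) e(1) posX(1,2)]
      note e2 = mult_le_eqD[OF le(3,4) e(2) posX(3,4)]
      have L: "H \<inter> A = L" by (rule card_subset_eq[OF finX(1) LX(2) e1(1)])
      have X: "K <#> A = X" by (rule card_subset_eq[OF finX(2) KA e1(2)])
      have X': "H <#> A = X'" by (rule card_subset_eq[OF finX(4) HA e2(2)])
      \<comment> \<open>Otherwise \<open>nondeg\<close> yields elements of \<open>H <#> A\<close>
        and \<open>K <#> A\<close> no translates of which by \<open>A\<close> commute. But suitable
        translates lie in \<open>H\<close> and \<open>K\<close>, which commute.\<close>
      have "X = A \<or> X' = A"
      proof (rule ccontr)
        assume "\<not> ?thesis"
        then obtain x y where xy: "x \<in> X'" "y \<in> X"
          "\<forall>a\<in>A. \<forall>b\<in>A. (x \<otimes> a) \<otimes> (y \<otimes> b) \<noteq> (y \<otimes> b) \<otimes> (x \<otimes> a)"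
          using nondeg[OF LX'(1) LX(1)] by metis
        from xy X' obtain h a where h: "h \<in> H" "a \<in> A" "x = h \<otimes> a" by (auto simp: set_mult_def)
        from xy X obtain k b where k: "k \<in> K" "b \<in> A" "y = k \<otimes> b" by (auto simp: set_mult_def)
        have "x \<otimes> inv a = h" "y \<otimes> inv b = k"
          using h k by (simp_all add: m_assoc)
        then show False using xy(3)[rule_format, of "inv a" "inv b"] h k comm[OF h(1) k(1)] by simp
      qed
      then show ?thesis
      proof
        assume "X' = A"
        then have "H = L" using L LX'(3) by blast
        then have "H = fst (L, X)" by simp
        then show ?thesis using LX(1) by blast
      next
        assume "X = A"
        \<comment> \<open>Here \<open>L\<close> has the order of \<open>A\<close>, hence
          \<open>A \<subseteq> H\<close>; so \<open>H\<close> absorbs \<open>A\<close> and equals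
          \<open>X'\<close>.\<close>
        then have "card L = card A" using cards(1) posX(5) by simp
        moreover have "finite A" "L \<subseteq> A" using finX(2) \<open>X = A\<close> p by simp_all
        ultimately have "L = A" by (simp add: card_subset_eq)
        then have AH: "A \<subseteq> H" using L by blast
        have "H <#> A \<subseteq> H" using AH by (auto simp: set_mult_def)
        then have "H = X'" using X' LX'(3) by blast
        then have "H = snd (L', X')" by simp
        then show ?thesis using LX'(1) by blast
      qed
    qed
    ultimately show ?thesis by blast
  qed
  \<comment> \<open>The members of a pair centralize each other, so each has measure at least
    \<open>card L * card X\<close>.\<close>
  have lower: "card A * card A \<le> cd_measure G L" "card A * card A \<le> cd_measure G X"
    if LX: "(L, X) \<in> \<P>" for L X
  proof -
    note p = pairs[OF LX]
    have sub: "L \<subseteq> carrier G" "X \<subseteq> carrier G" using p subgroup.subset by blast+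
    have cen: "L \<subseteq> centralizer G X" "X \<subseteq> centralizer G L"
    proof -
      show "X \<subseteq> centralizer G L" using p by blast
      then have "\<forall>x\<in>X. \<forall>l\<in>L. x \<otimes> l = l \<otimes> x" unfolding centralizer_def by blast
      then have "\<forall>l\<in>L. \<forall>x\<in>X. l \<otimes> x = x \<otimes> l" by metis
      then show "L \<subseteq> centralizer G X" using sub(1) unfolding centralizer_def by blast
    qed
    have "finite (centralizer G S)" for S by (rule finS) (simp add: centralizer_def)
    then have "card L \<le> card (centralizer G X)" "card X \<le> card (centralizer G L)"
      using cen by (simp_all add: card_mono)
    then have "card L * card X \<le> cd_measure G L" "card X * card L \<le> cd_measure G X"
      unfolding cd_measure_def by simp_all
    then show "card A * card A \<le> cd_measure G L" "card A * card A \<le> cd_measure G X"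
      using p by (simp_all add: mult.commute)
  qed
  \<comment> \<open>\<open>cover\<close> for two empty sets supplies some pair, so the upper bound
    is attained.\<close>
  obtain L X where LX: "(L, X) \<in> \<P>" using cover[of "{}" "{}"] by auto
  have "max_cd_measure G = card A * card A"
    unfolding max_cd_measure_def
  proof (rule Max_eqI)
    have "{H. subgroup H G} \<subseteq> Pow (carrier G)" using subgroup.subset by blast
    then show "finite (cd_measure G ` {H. subgroup H G})" using fin finite_subset by blast
    show "card A * card A \<in> cd_measure G ` {H. subgroup H G}"
      using lower(1)[OF LX] upper pairs[OF LX] by (metis imageI le_antisym mem_Collect_eq)
  qed (use upper in auto)
  then have CD: "CD G = {H. subgroup H G \<and> cd_measure G H = card A * card A}"
    by (simp add: CD_def)
  have "H \<in> CD G" if H: "H \<in> fst ` \<P> \<union> snd ` \<P>" for H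
  proof -
    obtain L X where LX: "(L, X) \<in> \<P>" "H = L \<or> H = X" using H by auto
    then have "subgroup H G" "card A * card A \<le> cd_measure G H"
      using pairs[OF LX(1)] lower[OF LX(1)] by blast+
    then show ?thesis using upper unfolding CD by (simp add: le_antisym)
  qed
  moreover have "H \<in> fst ` \<P> \<union> snd ` \<P>" if "H \<in> CD G" for H
    using that upper unfolding CD by blast
  ultimately show ?thesis by blast
qed

section \<open>Central extensions given by bilinear maps\<close>

text \<open>The group is built from coordinate vectors, while the theorem asks for natural numbers
  as elements. The isomorphism \<open>c\<close> back to the vectors keeps the coordinates
  available.\<close>

lemma (in group) nat_group_iso:
  assumes "finite (carrier G)"
  obtains P :: "nat monoid" and c where "group P" "c \<in> iso P G"
proof -
  obtain f :: "'a \<Rightarrow> nat" where f: "inj_on f (carrier G)"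
    using finite_imp_inj_to_nat_seg[OF assms] by blast
  define g where "g = inv_into (carrier G) f"
  have gf: "g (f x) = x" if "x \<in> carrier G" for x using that f by (simp add: g_def)
  define P :: "nat monoid" where
    "P = \<lparr>carrier = f ` carrier G, monoid.mult = (\<lambda>a b. f (g a \<otimes> g b)), one = f \<one>\<rparr>"
  have grp: "group P"
  proof (rule groupI)
    fix x assume "x \<in> carrier P"
    then obtain a where a: "a \<in> carrier G" "x = f a" by (auto simp: P_def)
    then show "\<exists>y\<in>carrier P. y \<otimes>\<^bsub>P\<^esub> x = \<one>\<^bsub>P\<^esub>"
      by (intro bexI[of _ "f (inv a)"]) (simp_all add: P_def gf)
  qed (auto simp: P_def gf m_assoc)
  have "g \<in> iso P G"
  proof (rule isoI)
    show "g \<in> hom P G" by (rule homI) (auto simp: P_def gf)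
    show "bij_betw g (carrier P) (carrier G)"
      using bij_betw_inv_into[of f "carrier G" "f ` carrier G"] f
      by (simp add: P_def g_def bij_betw_def)
  qed
  with grp show thesis by (rule that)
qed

definition bilinear_group :: "nat \<Rightarrow> nat \<Rightarrow> (nat \<Rightarrow> nat set) \<Rightarrow> (nat \<Rightarrow> nat set) \<Rightarrow> (nat \<Rightarrow> int) monoid" where
  "bilinear_group p N L R = \<lparr>carrier = {..<N} \<rightarrow>\<^sub>E {0..<int p},
     monoid.mult = (\<lambda>x y. \<lambda>i\<in>{..<N}. (x i + y i + sum x (L i) * sum y (R i)) mod int p),
     one = (\<lambda>i\<in>{..<N}. 0)\<rparr>"

text \<open>The first \<open>n\<close> coordinates form the quotient, where the product is plain
  addition. The forms read only these, so the coordinates from \<open>n\<close> on are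
  central.\<close>

locale bilinear_extension =
  fixes p n N :: nat and L R :: "nat \<Rightarrow> nat set"
  assumes prime: "Factorial_Ring.prime p" and n_le: "n \<le> N"
    and L_sub: "\<And>i. L i \<subseteq> {..<n}" and R_sub: "\<And>i. R i \<subseteq> {..<n}"
    and L_empty: "\<And>i. i < n \<Longrightarrow> L i = {}"
begin

abbreviation "E \<equiv> bilinear_group p N L R"

lemma p_gt_1: "1 < int p" using prime_gt_1_nat[OF prime] by simp

lemma mult_nth: "i < N \<Longrightarrow> (x \<otimes>\<^bsub>E\<^esub> y) i = (x i + y i + sum x (L i) * sum y (R i)) mod int p"
  by (simp add: bilinear_group_def)

text \<open>The linear forms of the cocycle are additive modulo \<open>p\<close> on products;
  associativity rests on this.\<close>

lemma sum_mult:
  assumes "S \<subseteq> {..<n}"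
  shows "sum (x \<otimes>\<^bsub>E\<^esub> y) S mod int p = (sum x S + sum y S) mod int p"
proof -
  have "sum (x \<otimes>\<^bsub>E\<^esub> y) S = (\<Sum>i\<in>S. (x i + y i) mod int p)"
    using assms n_le by (intro sum.cong) (auto simp: mult_nth L_empty subset_iff)
  then show ?thesis by (simp add: mod_sum_eq sum.distrib)
qed

lemma group_bilinear: "group E"
proof (rule groupI)
  have "0 < int p" using p_gt_1 by simp
  then show "x \<otimes>\<^bsub>E\<^esub> y \<in> carrier E" for x y by (auto simp: bilinear_group_def)
  show "\<one>\<^bsub>E\<^esub> \<in> carrier E" using \<open>0 < int p\<close> by (auto simp: bilinear_group_def)
next
  fix x y z assume xyz: "x \<in> carrier E" "y \<in> carrier E" "z \<in> carrier E"
  \<comment> \<open>Both sides reduce to the sum of the three coordinates and the cocycle terms of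
    the pairs \<open>(x, y)\<close>, \<open>(x, z)\<close> and \<open>(y, z)\<close>.\<close>
  show "x \<otimes>\<^bsub>E\<^esub> y \<otimes>\<^bsub>E\<^esub> z = x \<otimes>\<^bsub>E\<^esub> (y \<otimes>\<^bsub>E\<^esub> z)"
  proof
    fix i
    show "(x \<otimes>\<^bsub>E\<^esub> y \<otimes>\<^bsub>E\<^esub> z) i = (x \<otimes>\<^bsub>E\<^esub> (y \<otimes>\<^bsub>E\<^esub> z)) i"
    proof (cases "i < N")
      case True
      let ?l = "\<lambda>x. sum x (L i)" and ?r = "\<lambda>x. sum x (R i)"
      have l: "?l (x \<otimes>\<^bsub>E\<^esub> y) * ?r z mod int p = (?l x + ?l y) * ?r z mod int p"
        using sum_mult[OF L_sub] by (metis mod_mult_left_eq)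
      have r: "?l x * ?r (y \<otimes>\<^bsub>E\<^esub> z) mod int p = ?l x * (?r y + ?r z) mod int p"
        using sum_mult[OF R_sub] by (metis mod_mult_right_eq)
      have "(x \<otimes>\<^bsub>E\<^esub> y \<otimes>\<^bsub>E\<^esub> z) i =
          ((x \<otimes>\<^bsub>E\<^esub> y) i + z i + ?l (x \<otimes>\<^bsub>E\<^esub> y) * ?r z mod int p) mod int p"
        using True by (simp add: mult_nth[of i "x \<otimes>\<^bsub>E\<^esub> y"] mod_add_right_eq)
      also have "\<dots> = ((x \<otimes>\<^bsub>E\<^esub> y) i + z i + (?l x + ?l y) * ?r z) mod int p"
        unfolding l by (simp only: mod_add_right_eq)
      also have "\<dots> = (x i + y i + ?l x * ?r y + (z i + (?l x + ?l y) * ?r z)) mod int p"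
        unfolding mult_nth[OF True, of x y] add.assoc[of _ "z i"] by (rule mod_add_left_eq)
      also have "\<dots> = (x i + (y i + z i + ?l y * ?r z) + ?l x * (?r y + ?r z)) mod int p"
        by (simp add: algebra_simps)
      also have "\<dots> = (x i + (y \<otimes>\<^bsub>E\<^esub> z) i + ?l x * (?r y + ?r z)) mod int p"
        unfolding mult_nth[OF True, of y z] by (metis mod_add_left_eq mod_add_right_eq)
      also have "\<dots> = (x i + (y \<otimes>\<^bsub>E\<^esub> z) i + ?l x * ?r (y \<otimes>\<^bsub>E\<^esub> z) mod int p) mod int p"
        unfolding r by (simp only: mod_add_right_eq)
      also have "\<dots> = (x \<otimes>\<^bsub>E\<^esub> (y \<otimes>\<^bsub>E\<^esub> z)) i"
        using True by (simp add: mult_nth[of i x "y \<otimes>\<^bsub>E\<^esub> z"] mod_add_right_eq)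
      finally show ?thesis .
    qed (simp add: bilinear_group_def)
  qed
next
  fix x assume x: "x \<in> carrier E"
  then have x': "x \<in> extensional {..<N}" "\<And>i. i < N \<Longrightarrow> 0 \<le> x i \<and> x i < int p"
    by (auto simp: bilinear_group_def PiE_iff)
  show "\<one>\<^bsub>E\<^esub> \<otimes>\<^bsub>E\<^esub> x = x"
  proof
    fix i
    have "sum \<one>\<^bsub>E\<^esub> (L i) = 0"
      using L_sub[of i] n_le by (intro sum.neutral) (auto simp: bilinear_group_def)
    then show "(\<one>\<^bsub>E\<^esub> \<otimes>\<^bsub>E\<^esub> x) i = x i"
      using x' by (cases "i < N") (auto simp: bilinear_group_def extensional_def)
  qed
  \<comment> \<open>The inverse is \<open>\<beta>(x, x) - x\<close>: on the quotient it is
    \<open>- x\<close>, so the cocycle of \<open>y\<close> and \<open>x\<close> is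
    \<open>- \<beta>(x, x)\<close>.\<close>
  define y where "y = (\<lambda>i\<in>{..<N}. (sum x (L i) * sum x (R i) - x i) mod int p)"
  have "y \<in> carrier E" using p_gt_1 by (auto simp: bilinear_group_def y_def)
  moreover have "y \<otimes>\<^bsub>E\<^esub> x = \<one>\<^bsub>E\<^esub>"
  proof
    fix i
    show "(y \<otimes>\<^bsub>E\<^esub> x) i = \<one>\<^bsub>E\<^esub> i"
    proof (cases "i < N")
      case True
      have "sum y (L i) = (\<Sum>j\<in>L i. (- x j) mod int p)"
        using L_sub[of i] n_le by (intro sum.cong) (auto simp: y_def L_empty subset_iff)
      then have "sum y (L i) mod int p = (- sum x (L i)) mod int p"
        by (simp add: mod_sum_eq sum_negf)
      then have l: "sum y (L i) * sum x (R i) mod int p = - sum x (L i) * sum x (R i) mod int p"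
        by (metis mod_mult_left_eq)
      have "(y \<otimes>\<^bsub>E\<^esub> x) i = (y i + x i + sum y (L i) * sum x (R i) mod int p) mod int p"
        using True by (simp add: mult_nth mod_add_right_eq)
      also have "\<dots> = (y i + (x i + - sum x (L i) * sum x (R i))) mod int p"
        unfolding l add.assoc[symmetric] by (simp only: mod_add_right_eq)
      also have "\<dots> = (sum x (L i) * sum x (R i) - x i + (x i + - sum x (L i) * sum x (R i))) mod int p"
        using True by (simp only: y_def restrict_apply lessThan_iff if_True mod_add_left_eq)
      finally show ?thesis using True by (simp add: bilinear_group_def)
    qed (simp add: bilinear_group_def)
  qed
  ultimately show "\<exists>y\<in>carrier E. y \<otimes>\<^bsub>E\<^esub> x = \<one>\<^bsub>E\<^esub>" by blast
qed

lemma finite_bilinear: "finite (carrier E)"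
  by (simp add: bilinear_group_def finite_PiE)

end

section \<open>Subgroups defined by vanishing coordinates, and the Frattini subgroup\<close>

locale coordinatized_group = bilinear_extension p n N L R + group P
  for p n N :: nat and L R :: "nat \<Rightarrow> nat set" and P (structure) +
  fixes c :: "'a \<Rightarrow> nat \<Rightarrow> int"
  assumes c_iso: "c \<in> iso P (bilinear_group p N L R)"
begin

text \<open>For \<open>I\<close> below \<open>n\<close> this is an intersection of kernels of
  homomorphisms to the integers modulo \<open>p\<close>, namely the preimage of a coordinate
  subspace of the quotient. Larger index sets give smaller subgroups.\<close>

definition Ker :: "nat set \<Rightarrow> 'a set" where
  "Ker I = {x \<in> carrier P. \<forall>i\<in>I. c x i = 0}"

lemma c_bij: "bij_betw c (carrier P) ({..<N} \<rightarrow>\<^sub>E {0..<int p})"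
  using c_iso by (simp add: iso_def bilinear_group_def)

lemma c_range:
  assumes "x \<in> carrier P" "i < N"
  shows "0 \<le> c x i" "c x i < int p"
  using bij_betwE[OF c_bij] assms by (auto dest!: bspec simp: PiE_iff)

lemma c_mult:
  assumes "x \<in> carrier P" "y \<in> carrier P" "i < N"
  shows "c (x \<otimes> y) i = (c x i + c y i + sum (c x) (L i) * sum (c y) (R i)) mod int p"
proof -
  have "c (x \<otimes> y) = c x \<otimes>\<^bsub>E\<^esub> c y" using c_iso assms by (simp add: iso_def hom_def)
  then show ?thesis using assms by (simp add: mult_nth)
qed

lemma c_mult_low:
  assumes "x \<in> carrier P" "y \<in> carrier P" "i < n"
  shows "c (x \<otimes> y) i = (c x i + c y i) mod int p"
  using assms n_le by (simp add: c_mult L_empty)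

lemma c_one: "i < N \<Longrightarrow> c \<one> i = 0"
  using hom_one[of c P E] c_iso group_bilinear is_group by (simp add: iso_def bilinear_group_def)

lemma c_inv_low:
  assumes "x \<in> carrier P" "i < n"
  shows "(c (inv x) i + c x i) mod int p = 0"
  using c_mult_low[of "inv x" x i] assms c_one[of i] n_le by simp

lemma c_eqI:
  assumes "x \<in> carrier P" "y \<in> carrier P" "\<And>i. i < N \<Longrightarrow> c x i = c y i"
  shows "x = y"
proof -
  have "c x = c y"
    using bij_betwE[OF c_bij] assms by (intro PiE_ext[of "c x" "{..<N}" "\<lambda>_. {0..<int p}"]) auto
  then show ?thesis using c_bij assms by (simp add: bij_betw_def inj_on_def)
qed

lemma c_surj:
  obtains x where "x \<in> carrier P" "\<And>i. i < N \<Longrightarrow> c x i = f i mod int p"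
proof -
  have "(\<lambda>i\<in>{..<N}. f i mod int p) \<in> c ` carrier P"
    using c_bij p_gt_1 by (auto simp: bij_betw_def)
  then obtain x where "x \<in> carrier P" "c x = (\<lambda>i\<in>{..<N}. f i mod int p)" by auto
  then show thesis by (intro that[of x]) simp_all
qed

text \<open>The additive part of the product is symmetric, so only the two values of the cocycle
  have to agree.\<close>

lemma commute_iff:
  assumes "x \<in> carrier P" "y \<in> carrier P"
  shows "x \<otimes> y = y \<otimes> x \<longleftrightarrow> (\<forall>i<N. sum (c x) (L i) * sum (c y) (R i) mod int p =
    sum (c y) (L i) * sum (c x) (R i) mod int p)"
proof -
  have "x \<otimes> y = y \<otimes> x \<longleftrightarrow> (\<forall>i<N. c (x \<otimes> y) i = c (y \<otimes> x) i)"
    using c_eqI[of "x \<otimes> y" "y \<otimes> x"] assms by auto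
  moreover have "c (x \<otimes> y) i = c (y \<otimes> x) i \<longleftrightarrow> sum (c x) (L i) * sum (c y) (R i) mod int p =
      sum (c y) (L i) * sum (c x) (R i) mod int p" if "i < N" for i
    using that assms by (simp add: c_mult mod_eq_dvd_iff algebra_simps)
  ultimately show ?thesis by blast
qed

lemma subgroup_Ker:
  assumes "I \<subseteq> {..<n}"
  shows "subgroup (Ker I) P"
proof (rule subgroupI)
  show "Ker I \<noteq> {}" using assms n_le by (auto simp: Ker_def subset_iff intro!: exI[of _ \<one>] c_one)
next
  fix a assume a: "a \<in> Ker I"
  have "c (inv a) i = 0" if "i \<in> I" for i
  proof -
    have "i < n" using that assms by blast
    then show ?thesis using c_inv_low[of a i] c_range[of "inv a" i] a that n_le by (simp add: Ker_def)
  qed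
  then show "inv a \<in> Ker I" using a by (simp add: Ker_def)
next
  fix a b assume "a \<in> Ker I" "b \<in> Ker I"
  then show "a \<otimes> b \<in> Ker I" using assms by (auto simp: Ker_def c_mult_low)
qed (simp add: Ker_def)

lemma card_Ker:
  assumes I: "I \<subseteq> {..<N}"
  shows "card (Ker I) = p ^ (N - card I)"
proof -
  have "c ` Ker I = (\<Pi>\<^sub>E i\<in>{..<N}. if i \<in> I then {0} else {0..<int p})" (is "_ = ?B")
  proof
    show "c ` Ker I \<subseteq> ?B"
    proof
      fix f assume "f \<in> c ` Ker I"
      then obtain x where x: "f = c x" "x \<in> carrier P" "\<forall>i\<in>I. c x i = 0" by (auto simp: Ker_def)
      then have "f \<in> {..<N} \<rightarrow>\<^sub>E {0..<int p}" using bij_betwE[OF c_bij] by blast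
      then show "f \<in> ?B" using x by (simp add: PiE_iff)
    qed
    show "?B \<subseteq> c ` Ker I"
    proof
      fix f assume f: "f \<in> ?B"
      have "f i \<in> {0..<int p}" if "i < N" for i
        using PiE_mem[OF f, of i] that p_gt_1 by (cases "i \<in> I") auto
      then have "f \<in> {..<N} \<rightarrow>\<^sub>E {0..<int p}" using f by (simp add: PiE_iff)
      then have "f \<in> c ` carrier P" using c_bij by (simp add: bij_betw_def)
      then obtain x where x: "x \<in> carrier P" "f = c x" by blast
      have "c x i = 0" if "i \<in> I" for i
        using PiE_mem[OF f, of i] that I x(2) by auto
      then have "x \<in> Ker I" using x(1) by (simp add: Ker_def)
      then show "f \<in> c ` Ker I" using x by blast
    qed
  qed
  moreover have "inj_on c (Ker I)" using c_bij by (auto simp: bij_betw_def Ker_def inj_on_def)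
  ultimately have "card (Ker I) = card ?B" by (metis card_image)
  also have "\<dots> = (\<Prod>i\<in>{..<N}. if i \<in> I then 1 else p)"
    by (simp add: card_PiE if_distrib cong: if_cong)
  also have "\<dots> = p ^ card ({..<N} - I)" by (simp add: prod.If_cases Diff_eq)
  also have "card ({..<N} - I) = N - card I" using I by (simp add: card_Diff_subset finite_subset)
  finally show ?thesis .
qed

lemma Ker_empty: "Ker {} = carrier P" by (simp add: Ker_def)

lemma order_eq: "order P = p ^ N"
  using card_Ker[of "{}"] by (simp add: order_def Ker_empty)

lemma finite_P: "finite (carrier P)"
  using c_bij bij_betw_finite finite_PiE[of "{..<N}" "\<lambda>_. {0..<int p}"] by fastforce

lemma set_mult_Ker:
  assumes I: "I \<subseteq> {..<n}" and J: "J \<subseteq> {..<n}"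
  shows "Ker I <#> Ker J = Ker (I \<inter> J)"
proof
  have "Ker I <#> Ker J \<subseteq> Ker (I \<inter> J) <#> Ker (I \<inter> J)"
    by (rule mono_set_mult) (auto simp: Ker_def)
  also have "\<dots> = Ker (I \<inter> J)"
    using subgroup_Ker[of "I \<inter> J"] I by (intro subgroup_mult_id) auto
  finally show "Ker I <#> Ker J \<subseteq> Ker (I \<inter> J)" .
  show "Ker (I \<inter> J) \<subseteq> Ker I <#> Ker J"
  proof
    fix x assume x: "x \<in> Ker (I \<inter> J)"
    then have xP: "x \<in> carrier P" by (simp add: Ker_def)
    \<comment> \<open>The factor \<open>y\<close> vanishes on \<open>I\<close> and copies
      \<open>x\<close> elsewhere. On \<open>J\<close> it agrees with \<open>x\<close>, since
      \<open>x\<close> vanishes on \<open>I \<inter> J\<close>; hence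
      \<open>inv y \<otimes> x\<close> lies in \<open>Ker J\<close>.\<close>
    obtain y where y: "y \<in> carrier P" "\<And>i. i < N \<Longrightarrow> c y i = (if i \<in> I then 0 else c x i) mod int p"
      using c_surj[of "\<lambda>i. if i \<in> I then 0 else c x i"] by blast
    have yI: "y \<in> Ker I" using y I n_le by (auto simp: Ker_def subset_iff)
    have "c (inv y \<otimes> x) i = 0" if "i \<in> J" for i
    proof -
      have i: "i < n" "i < N" using that J n_le by auto
      have "c y i = c x i"
        using y(2)[OF i(2)] x that c_range[OF xP i(2)] by (auto simp: Ker_def)
      then show ?thesis
        using c_mult_low[OF inv_closed[OF y(1)] xP i(1)] c_inv_low[OF y(1) i(1)] by simp
    qed
    then have "inv y \<otimes> x \<in> Ker J" using y(1) xP by (simp add: Ker_def)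
    moreover have "x = y \<otimes> (inv y \<otimes> x)" using y(1) xP by (simp flip: m_assoc)
    ultimately show "x \<in> Ker I <#> Ker J" using yI unfolding set_mult_def by blast
  qed
qed

text \<open>The unit vector at a coordinate of \<open>J\<close> outside \<open>I\<close> separates
  the two sets. Every comparison of the seven subgroups thereby becomes one of explicit index
  sets.\<close>

lemma Ker_subset_iff:
  assumes "I \<subseteq> {..<N}" "J \<subseteq> {..<N}"
  shows "Ker I \<subseteq> Ker J \<longleftrightarrow> J \<subseteq> I"
proof
  assume sub: "Ker I \<subseteq> Ker J"
  show "J \<subseteq> I"
  proof
    fix j assume j: "j \<in> J"
    then have jN: "j < N" using assms by blast
    obtain x where x: "x \<in> carrier P" "\<And>i. i < N \<Longrightarrow> c x i = (if i = j then 1 else 0) mod int p"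
      using c_surj[of "\<lambda>i. if i = j then 1 else 0"] by blast
    have "c x j \<noteq> 0" using x(2)[OF jN] p_gt_1 by simp
    then have "x \<notin> Ker J" using j unfolding Ker_def by blast
    then have "x \<notin> Ker I" using sub by blast
    then obtain i where i: "i \<in> I" "c x i \<noteq> 0" using x(1) by (auto simp: Ker_def)
    then have "i = j" using x(2)[of i] assms(1) by (auto split: if_splits)
    then show "j \<in> I" using i by simp
  qed
qed (auto simp: Ker_def)

text \<open>The index is the prime \<open>p\<close>: by Lagrange, a subgroup above it has order
  \<open>p ^ (N - 1)\<close> or \<open>p ^ N\<close>.\<close>

lemma maximal_subgroup_Ker_singleton:
  assumes i: "i < n"
  shows "maximal_subgroup (Ker {i}) P"
  unfolding maximal_subgroup_def
proof (intro conjI allI impI)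
  have iN: "i < N" using i n_le by simp
  have card: "card (Ker {i}) = p ^ (N - 1)" using card_Ker[of "{i}"] iN by simp
  have p1: "1 < p" using p_gt_1 by simp
  show "subgroup (Ker {i}) P" using i by (intro subgroup_Ker) simp
  show "Ker {i} \<noteq> carrier P"
    using card order_eq p1 iN by (auto simp: order_def)
  fix H assume H: "subgroup H P \<and> Ker {i} \<subseteq> H"
  then have HP: "H \<subseteq> carrier P" by (simp add: subgroup.subset)
  then have fin: "finite H" using finite_P finite_subset by blast
  have "card H dvd p ^ N"
    using lagrange[of H] H order_eq by (metis dvd_triv_right)
  then obtain k where k: "k \<le> N" "card H = p ^ k" using divides_primepow_nat[OF prime] by blast
  have "card (Ker {i}) \<le> card H" using H by (intro card_mono fin) simp
  then have "p ^ (N - 1) \<le> p ^ k" by (simp only: card k(2))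
  then have "N - 1 \<le> k" by (rule power_le_imp_le_exp[OF p1])
  then have "k = N - 1 \<or> k = N" using k by linarith
  then show "H = Ker {i} \<or> H = carrier P"
  proof
    assume "k = N - 1"
    then have "card (Ker {i}) = card H" using card k(2) by simp
    then have "Ker {i} = H" using card_subset_eq[OF fin] H by blast
    then show ?thesis by simp
  next
    assume "k = N"
    then have "card H = card (carrier P)" using k(2) order_eq by (simp add: order_def)
    then have "H = carrier P" by (rule card_subset_eq[OF finite_P HP])
    then show ?thesis by simp
  qed
qed

text \<open>The maximal subgroups \<open>Ker {i}\<close> for \<open>i < n\<close> meet in
  \<open>Ker {..<n}\<close>.\<close>

lemma frattini_subset_Ker: "frattini P \<subseteq> Ker {..<n}"
proof
  fix x assume x: "x \<in> frattini P"
  then have "x \<in> Ker {i}" if "i < n" for i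
    using maximal_subgroup_Ker_singleton[OF that] by (auto simp: frattini_def)
  then show "x \<in> Ker {..<n}" using x by (auto simp: Ker_def frattini_def)
qed

end

section \<open>A group of order \<open>p\<^sup>1\<^sup>7\<close>\<close>

text \<open>The coordinates \<open>0, 1\<close>; \<open>2, 3\<close>; \<open>4, 5\<close>; \<open>6, 7\<close> of \<open>V\<close> belong to
  \<open>V\<^sub>1, V\<^sub>2, W\<^sub>1, W\<^sub>2\<close>. The central coordinates \<open>8, \<dots>, 11\<close> carry
  \<open>W\<^sub>2 \<otimes> V\<^sub>1\<close>, the coordinates \<open>12, \<dots>, 15\<close> carry \<open>W\<^sub>1 \<otimes> V\<^sub>2\<close>, and \<open>16\<close>
  carries \<open>\<omega>\<close>.\<close>

definition lft :: "nat \<Rightarrow> nat set" where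
  "lft i = (if i < 8 then {} else if i < 12 then {6 + i mod 2} else if i < 16 then {4 + i mod 2} else {4, 6})"

text \<open>Coordinates 8 to 15 run through the products of one W-coordinate and one V-coordinate.
  Antisymmetrized, coordinate 16 is the determinant form on the plane pulled back along the sum map
  \<open>(w\<^sub>1, w\<^sub>2) \<mapsto> w\<^sub>1 + w\<^sub>2\<close>; so it is nonzero on each
  \<open>W\<^sub>i \<times> W\<^sub>j\<close>, also for \<open>i = j\<close>.\<close>

definition rgt :: "nat \<Rightarrow> nat set" where
  "rgt i = (if i < 8 then {} else if i < 16 then {(i - 8) div 2} else {5, 7})"

lemma lft_rgt_eqs:
  "lft 8 = {6}" "lft 9 = {7}" "lft 10 = {6}" "lft 11 = {7}" "lft 12 = {4}" "lft 13 = {5}"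
  "lft 14 = {4}" "lft 15 = {5}" "lft 16 = {4, 6}"
  "rgt 8 = {0}" "rgt 9 = {0}" "rgt 10 = {1}" "rgt 11 = {1}" "rgt 12 = {2}" "rgt 13 = {2}"
  "rgt 14 = {3}" "rgt 15 = {3}" "rgt 16 = {5, 7}"
  by (simp_all add: lft_def rgt_def)

lemma bilinear_extension_lft_rgt:
  assumes "Factorial_Ring.prime p"
  shows "bilinear_extension p 8 17 lft rgt"
proof
  fix i :: nat
  show "lft i \<subseteq> {..<8}" by (auto simp: lft_def)
  show "rgt i \<subseteq> {..<8}" by (auto simp: rgt_def)
  show "i < 8 \<Longrightarrow> lft i = {}" by (simp add: lft_def)
qed (use assms in simp_all)

lemma all_less_17:
  "(\<forall>i<17. Q i) \<longleftrightarrow> (\<forall>i<8. Q i) \<and> Q 8 \<and> Q 9 \<and> Q 10 \<and> Q 11 \<and> Q 12 \<and> Q 13 \<and> Q 14 \<and> Q 15 \<and> Q (16::nat)"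
proof -
  have "i < 17 \<longleftrightarrow> i < 8 \<or> i \<in> {8, 9, 10, 11, 12, 13, 14, 15, 16}" for i :: nat
    by (simp, presburger)
  then show ?thesis by simp blast
qed

section \<open>Commutation with elements of \<open>A\<close> and the dual pairs\<close>

locale two_string_group = coordinatized_group p 8 17 lft rgt P c
  for p :: nat and P (structure) and c
begin

lemma commute_iff_coords:
  assumes "x \<in> carrier P" "y \<in> carrier P"
  shows "x \<otimes> y = y \<otimes> x \<longleftrightarrow>
    c x 6 * c y 0 mod int p = c y 6 * c x 0 mod int p \<and> c x 7 * c y 0 mod int p = c y 7 * c x 0 mod int p \<and>
    c x 6 * c y 1 mod int p = c y 6 * c x 1 mod int p \<and> c x 7 * c y 1 mod int p = c y 7 * c x 1 mod int p \<and>
    c x 4 * c y 2 mod int p = c y 4 * c x 2 mod int p \<and> c x 5 * c y 2 mod int p = c y 5 * c x 2 mod int p \<and>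
    c x 4 * c y 3 mod int p = c y 4 * c x 3 mod int p \<and> c x 5 * c y 3 mod int p = c y 5 * c x 3 mod int p \<and>
    (c x 4 + c x 6) * (c y 5 + c y 7) mod int p = (c y 4 + c y 6) * (c x 5 + c x 7) mod int p"
  unfolding commute_iff[OF assms] all_less_17 lft_rgt_eqs by (simp add: L_empty)

text \<open>The field of \<open>p\<close> elements has no zero divisors, and the coordinates are
  reduced modulo \<open>p\<close>.\<close>

lemma mult_mod_eq_0_iff:
  assumes "x \<in> carrier P" "y \<in> carrier P" "i < 8" "j < 8"
  shows "c x i * c y j mod int p = 0 \<longleftrightarrow> c x i = 0 \<or> c y j = 0"
proof -
  have "prime (int p)" using prime by simp
  then have "c x i * c y j mod int p = 0 \<longleftrightarrow> c x i mod int p = 0 \<or> c y j mod int p = 0"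
    by (simp add: mod_eq_0_iff_dvd prime_dvd_mult_iff)
  then show ?thesis using assms by (simp add: c_range)
qed

text \<open>The W-coordinates of \<open>s\<close> vanish, which kills the form in coordinate 16 and
  one side of every other equation. What remains is the vanishing of two pure tensors, each of which
  must have a zero factor.\<close>

lemma commute_Ker_iff:
  assumes "s \<in> Ker {4, 5, 6, 7}" "t \<in> carrier P"
  shows "s \<otimes> t = t \<otimes> s \<longleftrightarrow>
    (c s 0 = 0 \<and> c s 1 = 0 \<or> c t 6 = 0 \<and> c t 7 = 0) \<and> (c s 2 = 0 \<and> c s 3 = 0 \<or> c t 4 = 0 \<and> c t 5 = 0)"
proof -
  have s: "s \<in> carrier P" "c s 4 = 0" "c s 5 = 0" "c s 6 = 0" "c s 7 = 0" using assms by (auto simp: Ker_def)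
  show ?thesis
    unfolding commute_iff_coords[OF s(1) assms(2)]
    by (simp add: s mult_mod_eq_0_iff[OF assms(2) s(1)] eq_commute[of "0::int"]) blast
qed

text \<open>In order: \<open>(Z(P), P)\<close>, \<open>(A\<^sub>1, AB\<^sub>1)\<close>,
  \<open>(A\<^sub>2, AB\<^sub>2)\<close>, \<open>(A, A)\<close>, where \<open>A\<close> is
  \<open>Ker {4,5,6,7}\<close>.\<close>

definition dual_pairs where
  "dual_pairs = {(Ker {0,1,2,3,4,5,6,7}, Ker {}), (Ker {2,3,4,5,6,7}, Ker {6,7}),
     (Ker {0,1,4,5,6,7}, Ker {4,5}), (Ker {4,5,6,7}, Ker {4,5,6,7})}"

text \<open>Each of the two tensors gives an alternative between \<open>S\<close> and
  \<open>T\<close>; the four combinations match the four pairs.\<close>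

lemma dual_pairs_cover:
  assumes S: "S \<subseteq> Ker {4,5,6,7}" and T: "T \<subseteq> centralizer P S"
  shows "\<exists>L X. (L, X) \<in> dual_pairs \<and> S \<subseteq> L \<and> T \<subseteq> X"
proof -
  have TP: "T \<subseteq> carrier P" using T by (auto simp: centralizer_def)
  have "s \<otimes> t = t \<otimes> s" if "s \<in> S" "t \<in> T" for s t
  proof -
    have "t \<otimes> s = s \<otimes> t" using that T unfolding centralizer_def by blast
    then show ?thesis by (rule sym)
  qed
  then have *: "(c s 0 = 0 \<and> c s 1 = 0 \<or> c t 6 = 0 \<and> c t 7 = 0) \<and>
      (c s 2 = 0 \<and> c s 3 = 0 \<or> c t 4 = 0 \<and> c t 5 = 0)" if "s \<in> S" "t \<in> T" for s t
    using commute_Ker_iff[of s t] that S TP by blast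
  \<comment> \<open>An alternative holding for all \<open>s\<close> and \<open>t\<close> whose sides
    depend on \<open>s\<close> alone and on \<open>t\<close> alone is decided uniformly.\<close>
  then have d: "(\<forall>s\<in>S. c s 0 = 0 \<and> c s 1 = 0) \<or> (\<forall>t\<in>T. c t 6 = 0 \<and> c t 7 = 0)"
    "(\<forall>s\<in>S. c s 2 = 0 \<and> c s 3 = 0) \<or> (\<forall>t\<in>T. c t 4 = 0 \<and> c t 5 = 0)" by meson+
  have SP: "\<forall>s\<in>S. s \<in> carrier P \<and> c s 4 = 0 \<and> c s 5 = 0 \<and> c s 6 = 0 \<and> c s 7 = 0"
    using S by (auto simp: Ker_def)
  have ex: "\<exists>L X. (L, X) \<in> dual_pairs \<and> S \<subseteq> L \<and> T \<subseteq> X"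
    if "(Ker I, Ker J) \<in> dual_pairs" "\<forall>s\<in>S. \<forall>i\<in>I. c s i = 0" "\<forall>t\<in>T. \<forall>j\<in>J. c t j = 0" for I J
  proof -
    have "S \<subseteq> Ker I" "T \<subseteq> Ker J" using that(2,3) SP TP unfolding Ker_def by blast+
    then show ?thesis using that(1) by blast
  qed
  from d show ?thesis
  proof (elim disjE)
    assume "\<forall>s\<in>S. c s 0 = 0 \<and> c s 1 = 0" "\<forall>s\<in>S. c s 2 = 0 \<and> c s 3 = 0"
    then show ?thesis
      using SP by (intro ex[of "{0,1,2,3,4,5,6,7}" "{}"]) (simp_all add: dual_pairs_def)
  next
    assume "\<forall>s\<in>S. c s 0 = 0 \<and> c s 1 = 0" "\<forall>t\<in>T. c t 4 = 0 \<and> c t 5 = 0"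
    then show ?thesis
      using SP by (intro ex[of "{0,1,4,5,6,7}" "{4,5}"]) (simp_all add: dual_pairs_def)
  next
    assume "\<forall>t\<in>T. c t 6 = 0 \<and> c t 7 = 0" "\<forall>s\<in>S. c s 2 = 0 \<and> c s 3 = 0"
    then show ?thesis
      using SP by (intro ex[of "{2,3,4,5,6,7}" "{6,7}"]) (simp_all add: dual_pairs_def)
  next
    assume "\<forall>t\<in>T. c t 6 = 0 \<and> c t 7 = 0" "\<forall>t\<in>T. c t 4 = 0 \<and> c t 5 = 0"
    then show ?thesis
      using SP by (intro ex[of "{4,5,6,7}" "{4,5,6,7}"]) (simp_all add: dual_pairs_def)
  qed
qed

lemma dual_pairs_props:
  assumes "(L, X) \<in> dual_pairs"
  shows "subgroup L P \<and> subgroup X P \<and> L \<subseteq> Ker {4,5,6,7} \<and> Ker {4,5,6,7} \<subseteq> X \<and>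
    X \<subseteq> centralizer P L \<and> card L * card X = card (Ker {4,5,6,7}) * card (Ker {4,5,6,7})"
proof -
  have cen: "Ker J \<subseteq> centralizer P (Ker I)"
    if "Ker I \<subseteq> Ker {4,5,6,7}" "0 \<in> I \<and> 1 \<in> I \<or> 6 \<in> J \<and> 7 \<in> J" "2 \<in> I \<and> 3 \<in> I \<or> 4 \<in> J \<and> 5 \<in> J" for I J
  proof
    fix t assume t: "t \<in> Ker J"
    then have tP: "t \<in> carrier P" by (simp add: Ker_def)
    have "s \<otimes> t = t \<otimes> s" if s: "s \<in> Ker I" for s
      using commute_Ker_iff[of s t] that \<open>Ker I \<subseteq> _\<close> tP t s \<open>0 \<in> I \<and> 1 \<in> I \<or> _\<close> \<open>2 \<in> I \<and> 3 \<in> I \<or> _\<close>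
      unfolding Ker_def by blast
    then have "\<forall>s\<in>Ker I. t \<otimes> s = s \<otimes> t" by metis
    then show "t \<in> centralizer P (Ker I)" using tP unfolding centralizer_def by blast
  qed
  \<comment> \<open>\<open>A\<close> has order \<open>p ^ 13\<close>, and the exponents in the pairs
    are 9 and 17, 11 and 15, 13 and 13.\<close>
  have pow: "p ^ a * p ^ b = p ^ 13 * p ^ 13" if "a + b = 26" for a b
    using that by (simp flip: power_add)
  have "subgroup (Ker {0,1,2,3,4,5,6,7}) P" "subgroup (Ker {}) P" "subgroup (Ker {2,3,4,5,6,7}) P"
    "subgroup (Ker {6,7}) P" "subgroup (Ker {0,1,4,5,6,7}) P" "subgroup (Ker {4,5}) P" "subgroup (Ker {4,5,6,7}) P"
    by (rule subgroup_Ker; simp)+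
  moreover have "card (Ker {0,1,2,3,4,5,6,7}) = p ^ 9" "card (Ker {}) = p ^ 17" "card (Ker {2,3,4,5,6,7}) = p ^ 11"
    "card (Ker {6,7}) = p ^ 15" "card (Ker {0,1,4,5,6,7}) = p ^ 11" "card (Ker {4,5}) = p ^ 15"
    "card (Ker {4,5,6,7}) = p ^ 13"
    by (simp_all add: card_Ker)
  moreover from assms have "(\<exists>I J. L = Ker I \<and> X = Ker J \<and> (I, J) \<in> {({0,1,2,3,4,5,6,7}, {}),
      ({2,3,4,5,6,7}, {6,7}), ({0,1,4,5,6,7}, {4,5}), ({4,5,6,7}, {4,5,6,7})})"
    unfolding dual_pairs_def by blast
  ultimately show ?thesis
    by (elim exE conjE insertE emptyE) (simp_all add: cen Ker_subset_iff pow)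
qed

text \<open>An \<open>X\<close> other than \<open>A\<close> contains the preimage of some
  \<open>W\<^sub>i\<close>. With \<open>x\<close> over the first basis vector of one such plane and
  \<open>y\<close> over the second basis vector of another, the form in coordinate 16 takes the
  value 1.\<close>

lemma dual_pairs_nondegenerate:
  assumes "(L, X) \<in> dual_pairs" "(L', X') \<in> dual_pairs" "X \<noteq> Ker {4,5,6,7}" "X' \<noteq> Ker {4,5,6,7}"
  shows "\<exists>x\<in>X. \<exists>y\<in>X'. \<forall>a\<in>Ker {4,5,6,7}. \<forall>b\<in>Ker {4,5,6,7}. (x \<otimes> a) \<otimes> (y \<otimes> b) \<noteq> (y \<otimes> b) \<otimes> (x \<otimes> a)"
proof -
  have unit: "\<exists>x\<in>Ker ({..<8} - {i}). c x i = 1" if "i < 8" for i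
  proof -
    obtain x where x: "x \<in> carrier P" "\<And>k. k < 17 \<Longrightarrow> c x k = (if k = i then 1 else 0) mod int p"
      using c_surj[of "\<lambda>k. if k = i then 1 else 0"] by blast
    then have "x \<in> Ker ({..<8} - {i})" by (auto simp: Ker_def)
    moreover have "c x i = 1" using x(2)[of i] that p_gt_1 by simp
    ultimately show ?thesis by blast
  qed
  \<comment> \<open>\<open>Ker ({..<8} - {i})\<close> is the preimage of the line spanned by the
    basis vector \<open>i\<close> of the quotient.\<close>
  have wide: "Ker ({..<8} - {4}) \<subseteq> Y \<and> Ker ({..<8} - {5}) \<subseteq> Y \<or> Ker ({..<8} - {6}) \<subseteq> Y \<and> Ker ({..<8} - {7}) \<subseteq> Y"
    if "(M, Y) \<in> dual_pairs" "Y \<noteq> Ker {4,5,6,7}" for M Y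
  proof -
    have "Y = Ker {} \<or> Y = Ker {6,7} \<or> Y = Ker {4,5}" using that unfolding dual_pairs_def by blast
    then show ?thesis by (auto simp: Ker_def)
  qed
  obtain x where x: "x \<in> X" "x \<in> carrier P" "c x 4 + c x 6 = 1" "c x 5 = 0" "c x 7 = 0"
  proof -
    obtain i where i: "i = 4 \<or> i = 6" "Ker ({..<8} - {i}) \<subseteq> X" using wide[OF assms(1,3)] by blast
    obtain x where "x \<in> Ker ({..<8} - {i})" "c x i = 1" using unit[of i] i(1) by auto
    then show thesis using i by (intro that[of x]) (auto simp: Ker_def)
  qed
  obtain y where y: "y \<in> X'" "y \<in> carrier P" "c y 5 + c y 7 = 1" "c y 4 = 0" "c y 6 = 0"
  proof -
    obtain i where i: "i = 5 \<or> i = 7" "Ker ({..<8} - {i}) \<subseteq> X'" using wide[OF assms(2,4)] by blast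
    obtain y where "y \<in> Ker ({..<8} - {i})" "c y i = 1" using unit[of i] i(1) by auto
    then show thesis using i by (intro that[of y]) (auto simp: Ker_def)
  qed
  \<comment> \<open>Translation by \<open>A\<close> leaves the W-coordinates, and hence the value of
    the form, unchanged.\<close>
  have shift: "c (z \<otimes> a) i = c z i" if "z \<in> carrier P" "a \<in> Ker {4,5,6,7}" "i \<in> {4,5,6,7}" for z a i
  proof -
    have "c a i = 0" "a \<in> carrier P" "i < 8" using that by (auto simp: Ker_def)
    then show ?thesis using that(1) by (simp add: c_mult_low c_range)
  qed
  have "(x \<otimes> a) \<otimes> (y \<otimes> b) \<noteq> (y \<otimes> b) \<otimes> (x \<otimes> a)" if a: "a \<in> Ker {4,5,6,7}" and b: "b \<in> Ker {4,5,6,7}" for a b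
  proof -
    have "a \<in> carrier P" "b \<in> carrier P" using a b by (simp_all add: Ker_def)
    then show ?thesis
      using x y p_gt_1 by (simp add: commute_iff_coords shift[OF x(2) a] shift[OF y(2) b])
  qed
  then show ?thesis using x(1) y(1) by blast
qed

section \<open>The Chermak-Delgado lattice and the center\<close>

lemma CD_eq: "CD P = {Ker {0,1,2,3,4,5,6,7}, Ker {2,3,4,5,6,7}, Ker {0,1,4,5,6,7}, Ker {4,5,6,7},
    Ker {6,7}, Ker {4,5}, carrier P}"
proof -
  have "CD P = fst ` dual_pairs \<union> snd ` dual_pairs"
    by (rule CD_eq_dual_pairs[where A = "Ker {4,5,6,7}", OF finite_P])
      (use dual_pairs_props dual_pairs_cover dual_pairs_nondegenerate subgroup_Ker in simp_all)
  also have "\<dots> = {Ker {0,1,2,3,4,5,6,7}, Ker {2,3,4,5,6,7}, Ker {0,1,4,5,6,7}, Ker {4,5,6,7},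
    Ker {6,7}, Ker {4,5}, carrier P}"
    unfolding dual_pairs_def Ker_empty by (simp, blast)
  finally show ?thesis .
qed

text \<open>For the upper bound the covering property is used twice. The center centralizes
  \<open>A\<close>, and only the pair \<open>(A, A)\<close> has a first member containing
  \<open>A\<close>, so the center lies in \<open>A\<close>. It is also centralized by
  \<open>P\<close>, and only one pair has \<open>P\<close> as second member.\<close>

lemma center_eq: "center P = Ker {0,1,2,3,4,5,6,7}"
proof
  have "(Ker {0,1,2,3,4,5,6,7}, Ker {}) \<in> dual_pairs" by (simp add: dual_pairs_def)
  then have "carrier P \<subseteq> centralizer P (Ker {0,1,2,3,4,5,6,7})"
    using dual_pairs_props unfolding Ker_empty by blast
  then have "g \<otimes> z = z \<otimes> g" if "z \<in> Ker {0,1,2,3,4,5,6,7}" "g \<in> carrier P" for z g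
    using that unfolding centralizer_def by blast
  then have "\<forall>g\<in>carrier P. z \<otimes> g = g \<otimes> z" if "z \<in> Ker {0,1,2,3,4,5,6,7}" for z
    using that by metis
  moreover have "Ker {0,1,2,3,4,5,6,7} \<subseteq> carrier P" unfolding Ker_def by blast
  ultimately show "Ker {0,1,2,3,4,5,6,7} \<subseteq> center P" unfolding center_def by blast
  have comm: "z \<otimes> g = g \<otimes> z" "g \<otimes> z = z \<otimes> g" if "z \<in> center P" "g \<in> carrier P" for z g
    using that by (simp_all add: center_def)
  have "center P \<subseteq> carrier P" by (auto simp: center_def)
  then have "center P \<subseteq> centralizer P (Ker {4,5,6,7})"
    using comm(1) unfolding centralizer_def Ker_def by blast
  then obtain L X where LX: "(L, X) \<in> dual_pairs" "Ker {4,5,6,7} \<subseteq> L" "center P \<subseteq> X"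
    using dual_pairs_cover[OF order_refl] by metis
  then have sub: "center P \<subseteq> Ker {4,5,6,7}"
    unfolding dual_pairs_def by (elim insertE emptyE) (simp_all add: Ker_subset_iff)
  have "carrier P \<subseteq> centralizer P (center P)"
    using comm(2) unfolding centralizer_def by blast
  then obtain L X where LX: "(L, X) \<in> dual_pairs" "center P \<subseteq> L" "Ker {} \<subseteq> X"
    using dual_pairs_cover[OF sub] unfolding Ker_empty by metis
  then show "center P \<subseteq> Ker {0,1,2,3,4,5,6,7}"
    unfolding dual_pairs_def by (elim insertE emptyE) (simp_all add: Ker_subset_iff)
qed

end

theorem theorem1p1:
  fixes p :: nat
  assumes "Factorial_Ring.prime p"
  shows "\<exists>P :: nat monoid. p_group p P \<and> frattini P \<subseteq> center P \<and>
    is_string_of_diamonds 2 2 (inclusion_order (CD P)) \<and>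
    (\<exists>A\<^sub>1 A\<^sub>2 A B\<^sub>1 B\<^sub>2.
       subgroup A\<^sub>1 P \<and> subgroup A\<^sub>2 P \<and> subgroup A P \<and> subgroup B\<^sub>1 P \<and> subgroup B\<^sub>2 P \<and>
       subgroup (A <#>\<^bsub>P\<^esub> B\<^sub>1) P \<and> subgroup (A <#>\<^bsub>P\<^esub> B\<^sub>2) P \<and>
       CD P = {center P, A\<^sub>1, A\<^sub>2, A, A <#>\<^bsub>P\<^esub> B\<^sub>1, A <#>\<^bsub>P\<^esub> B\<^sub>2, carrier P} \<and>
       distinct [center P, A\<^sub>1, A\<^sub>2, A, A <#>\<^bsub>P\<^esub> B\<^sub>1, A <#>\<^bsub>P\<^esub> B\<^sub>2, carrier P] \<and>
       (\<forall>S \<in> {A\<^sub>1, A\<^sub>2}. \<forall>T \<in> {A <#>\<^bsub>P\<^esub> B\<^sub>1, A <#>\<^bsub>P\<^esub> B\<^sub>2}.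
          center P \<subset> S \<and> S \<subset> A \<and> A \<subset> T \<and> T \<subset> carrier P))"
proof -
  interpret bilinear_extension p 8 17 lft rgt by (rule bilinear_extension_lft_rgt) (rule assms)
  obtain P :: "nat monoid" and c where P: "group P" "c \<in> iso P (bilinear_group p 17 lft rgt)"
    using group.nat_group_iso[OF group_bilinear finite_bilinear] by blast
  interpret two_string_group p P c
    using P by (intro two_string_group.intro coordinatized_group.intro coordinatized_group_axioms.intro
      bilinear_extension_axioms)
  have psub: "Ker I \<subset> Ker J \<longleftrightarrow> J \<subseteq> I \<and> \<not> I \<subseteq> J" if "I \<subseteq> {..<17}" "J \<subseteq> {..<17}" for I J
    unfolding less_le_not_le Ker_subset_iff[OF that] Ker_subset_iff[OF that(2,1)] ..
  have eq: "Ker I = Ker J \<longleftrightarrow> I \<subseteq> J \<and> J \<subseteq> I" if "I \<subseteq> {..<17}" "J \<subseteq> {..<17}" for I J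
    unfolding set_eq_subset[of "Ker I"] Ker_subset_iff[OF that] Ker_subset_iff[OF that(2,1)] by (rule conj_commute)
  \<comment> \<open>\<open>B\<^sub>1\<close> and \<open>B\<^sub>2\<close> are taken as the preimages
    of \<open>W\<^sub>1\<close> and \<open>W\<^sub>2\<close>; products of such subgroups correspond
    to intersections of index sets.\<close>
  have prods: "Ker {4,5,6,7} <#>\<^bsub>P\<^esub> Ker {0,1,2,3,6,7} = Ker {6,7}"
    "Ker {4,5,6,7} <#>\<^bsub>P\<^esub> Ker {0,1,2,3,4,5} = Ker {4,5}"
    by (simp_all add: set_mult_Ker)
  have subgroups: "subgroup (Ker I) P" if "I \<subseteq> {..<8}" for I using that by (rule subgroup_Ker)
  have "is_string_of_diamonds 2 2 (inclusion_order (CD P))"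
    \<comment> \<open>Writing the whole group as \<open>Ker {}\<close> lets index sets settle all
      comparisons.\<close>
    unfolding CD_eq Ker_empty[symmetric]
    by (rule is_string_of_diamonds_2_2_inclusion_order) (simp_all add: psub Ker_subset_iff)
  moreover have "p_group p P" using P(1) finite_P order_eq by (auto simp: p_group_def)
  moreover have "{..<8::nat} = {0,1,2,3,4,5,6,7}" by auto
  then have "frattini P \<subseteq> center P" using frattini_subset_Ker by (simp add: center_eq)
  moreover have "distinct [Ker {0,1,2,3,4,5,6,7}, Ker {2,3,4,5,6,7}, Ker {0,1,4,5,6,7}, Ker {4,5,6,7},
      Ker {6,7}, Ker {4,5}, Ker {}]"
    by (simp add: eq)
  moreover have "\<forall>S \<in> {Ker {2,3,4,5,6,7}, Ker {0,1,4,5,6,7}}. \<forall>T \<in> {Ker {6,7}, Ker {4,5}}.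
      Ker {0,1,2,3,4,5,6,7} \<subset> S \<and> S \<subset> Ker {4,5,6,7} \<and> Ker {4,5,6,7} \<subset> T \<and> T \<subset> Ker {}"
    by (simp add: psub)
  ultimately show ?thesis
    unfolding Ker_empty
    apply (intro exI[of _ P] conjI)
       apply assumption+
    apply (rule exI[of _ "Ker {2,3,4,5,6,7}"])
    apply (rule exI[of _ "Ker {0,1,4,5,6,7}"])
    apply (rule exI[of _ "Ker {4,5,6,7}"])
    apply (rule exI[of _ "Ker {0,1,2,3,6,7}"])
    apply (rule exI[of _ "Ker {0,1,2,3,4,5}"])
    unfolding prods center_eq
    by (intro conjI subgroups CD_eq) (assumption | simp)+
qed

end
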